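(* Let $P_n(x)$ ($n\in\mathbb N_0$) be the monic polynomial system given by the difference equation $\sigma(x)\Delta\nabla y(x)+\tau(x)\Delta y(x)+\lambda_ny(x)=0$ with $\sigma(x)=ax^2+bx+c$, $\tau(x)=dx+e$, $\lambda_n=-(an(n-1)+dn)$. Then the coefficients $C_m(n)$ given by $P_n(x)=\sum_{m=0}^nC_m(n)\,x^{\underline m}$ satisfy $$(an+am-a+d)(n-m)C_m(n)+(m+1)(an^2-2am^2-an-am+nd-2dm-bm-d-e)C_{m+1}(n)$$ $$-(m+1)(m+2)(am^2+2am+dm+bm+a+d+b+c+e)C_{m+2}(n)=0 .$$ If $c=0$, then $$(n-m)(am+d+an-a)C_m(n)-(m+1)(am^2+mb+md+e)C_{m+1}(n)=0,$$ and, with $r_\pm=\dfrac{b+d\pm\sqrt{(b+d)^2-4ae}}{2a}$, $$P_n(x)=\frac{\left(\frac da-1\right)_n(r_+)_n(r_-)_n}{\left(\frac d{2a}\right)_n\left(\frac{d-a}{2a}\right)_n}\left(\frac14\right)^n{}_3F_2\left(-n,-x,n-1+\tfrac da;\,r_+,r_-;\,1\right)\quad(a\neq0),$$ $$P_n(x)=\left(\frac e{b+d}\right)_n\left(1+\frac bd\right)^n{}_2F_1\left(-n,-x;\tfrac e{b+d};\tfrac d{b+d}\right)\quad(a=0,\ b+d\ne0),$$ $$P_n(x)=\left(-\frac eb\right)^n{}_2F_0\left(-n,-x;-;-\tfrac be\right)\quad(a=0,\ d=-b).$$ Therefore, the classical discrete orthogonal polynomials and their monic counterparts have the following representations: $$h_n^{(\alpha,\beta)}(x,N)=\frac{(-1)^n}{n!}(\beta+1)_n(N-n)_n\,{}_3F_2(-n,-x,n+1+\alpha+\beta;\beta+1,1-N;1),$$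 $$\widetilde h_n^{(\alpha,\beta)}(x,N)=\frac{(1+\beta)_n(1-N)_n}{(1+n+\alpha+\beta)_n}\,{}_3F_2(-n,-x,n+1+\alpha+\beta;\beta+1,1-N;1),$$ $$t_n(x,N)=(-1)^n(N-n)_n\,{}_3F_2(-n,-x,n+1;1,1-N;1),\qquad \widetilde t_n(x,N)=\frac{n!\,(1-N)_n}{(1/2)_n4^n}\,{}_3F_2(-n,-x,n+1;1,1-N;1),$$ $$Q_n(x;\alpha,\beta,N)={}_3F_2(-n,-x,n+1+\alpha+\beta;\alpha+1,-N;1),\qquad \widetilde Q_n(x;\alpha,\beta,N)=\widetilde h_n^{(\beta,\alpha)}(x,N+1),$$ $$m_n^{(\gamma,\mu)}(x)=(\gamma)_n\,{}_2F_1\left(-n,-x;\gamma;1-\tfrac1\mu\right),\qquad \widetilde m_n^{(\gamma,\mu)}(x)=(\gamma)_n\left(\tfrac\mu{\mu-1}\right)^n{}_2F_1\left(-n,-x;\gamma;1-\tfrac1\mu\right),$$ $$k_n^{(p)}(x,N)=(-1)^n\binom Nnp^n\,{}_2F_1\left(-n,-x;-N;\tfrac1p\right),\qquad \widetilde k_n^{(p)}(x,N)=(-N)_np^n\,{}_2F_1\left(-n,-x;-N;\tfrac1p\right),$$ $$c_n^{(\mu)}(x)={}_2F_0\left(-n,-x;-;-\tfrac1\mu\right),\qquad \widetilde c_n^{(\mu)}(x)=(-\mu)^n{}_2F_0\left(-n,-x;-;-\tfrac1\mu\right).$$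
   Context: $\Delta y(x)=y(x+1)-y(x)$, $\nabla y(x)=y(x)-y(x-1)$; $x^{\underline m}=x(x-1)\cdots(x-m+1)$ (falling factorial). "$P_n$ given by the difference equation" means: for each $n\in\mathbb N_0$, $P_n$ is the unique monic polynomial of degree $n$ solving the equation with $\lambda_n$ (equivalently $d+ka\ne0$ for all integers $k\ge0$). $n,m\in\mathbb N_0$ and $C_m(n)=0$ for $m>n$. $(u)_k=u(u+1)\cdots(u+k-1)$; ${}_pF_q(\text{upper};\text{lower};z)=\sum_k\frac{\prod(\text{upper})_k}{\prod(\text{lower})_k}\frac{z^k}{k!}$ ("$-$" denotes an empty parameter list); all series here terminate. Formulas are asserted for parameter values for which all occurring expressions are defined. The classical discrete families are the polynomial solutions of degree $n$ of $\sigma\Delta\nabla y+\tau\Delta y+\lambda_ny=0$ with leading coefficient $k_n$: Hahn $h_n^{(\alpha,\beta)}(x,N)$: $\sigma=x(N+\alpha-x)$, $\tau=(\beta+1)(N-1)-(\alpha+\beta+2)x$, $k_n=\binom{\alpha+\beta+2n}n$; discrete Chebyshev $t_n(x,N)=h_n^{(0,0)}(x,N)$; Hahn $Q_n(x;\alpha,\beta,N)$: $\sigma=x(N+1+\beta-x)$, $\tau=(\alpha+1)N-(\alpha+\beta+2)x$, $k_n=\frac{(\alpha+\beta+n+1)_n}{(-N)_n(\alpha+1)_n}$; Meixner $m_n^{(\gamma,\mu)}$: $\sigma=x$, $\tau=\gamma\mu-(1-\mu)x$, $k_n=(1-1/\mu)^n$; Krawtchouk $k_n^{(p)}(x,N)$: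 $\sigma=x$, $\tau=(Np-x)/(1-p)$, $k_n=1/n!$; Charlier $c_n^{(\mu)}$: $\sigma=x$, $\tau=\mu-x$, $k_n=(-1/\mu)^n$. A tilde denotes the monic version (divide by $k_n$). *)

theory Defs
  imports Complex_Main "HOL-Computational_Algebra.Polynomial"
begin

definition fwd_diff :: "(complex \<Rightarrow> complex) \<Rightarrow> complex \<Rightarrow> complex" ("\<Delta>") where
  "\<Delta> y x = y (x + 1) - y x"

definition bwd_diff :: "(complex \<Rightarrow> complex) \<Rightarrow> complex \<Rightarrow> complex" ("\<nabla>") where
  "\<nabla> y x = y x - y (x - 1)"

definition falling_fact :: "complex \<Rightarrow> nat \<Rightarrow> complex" where
  "falling_fact x m = (\<Prod>i<m. x - of_nat i)"

text \<open>If some upper parameter is \<open>-n\<close>, all terms with index above \<open>n\<close> are zero (also where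
  a lower Pochhammer symbol vanishes there, since division by zero yields zero), so the
  series is the finite sum over \<open>k \<le> n\<close>.\<close>

definition hypergeo :: "complex list \<Rightarrow> complex list \<Rightarrow> complex \<Rightarrow> complex" where
  "hypergeo as bs z =
     (\<Sum>k. prod_list (map (\<lambda>u. pochhammer u k) as) / prod_list (map (\<lambda>u. pochhammer u k) bs)
          * z ^ k / fact k)"

definition diff_eq ::
  "(complex \<Rightarrow> complex) \<Rightarrow> (complex \<Rightarrow> complex) \<Rightarrow> complex \<Rightarrow> (complex \<Rightarrow> complex) \<Rightarrow> bool" where
  "diff_eq \<sigma> \<tau> l y \<longleftrightarrow> (\<forall>x. \<sigma> x * \<Delta> (\<nabla> y) x + \<tau> x * \<Delta> y x + l * y x = 0)"

text \<open>\<open>\<lambda>\<^sub>n\<close> for \<open>\<sigma>(x) = a x\<^sup>2 + b x + c\<close> and \<open>\<tau>(x) = d x + e\<close>.\<close>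

definition eigval :: "complex \<Rightarrow> complex \<Rightarrow> nat \<Rightarrow> complex" where
  "eigval a d n = - (a * of_nat n * (of_nat n - 1) + d * of_nat n)"

definition poly_sol ::
  "(complex \<Rightarrow> complex) \<Rightarrow> (complex \<Rightarrow> complex) \<Rightarrow> complex \<Rightarrow> nat \<Rightarrow> complex \<Rightarrow> complex poly \<Rightarrow> bool" where
  "poly_sol \<sigma> \<tau> l n k p \<longleftrightarrow> degree p = n \<and> lead_coeff p = k \<and> diff_eq \<sigma> \<tau> l (poly p)"

definition monic_system ::
  "complex \<Rightarrow> complex \<Rightarrow> complex \<Rightarrow> complex \<Rightarrow> complex \<Rightarrow> (nat \<Rightarrow> complex poly) \<Rightarrow> bool" where
  "monic_system a b c d e P \<longleftrightarrow>
     (\<forall>n. poly_sol (\<lambda>x. a * x ^ 2 + b * x + c) (\<lambda>x. d * x + e) (eigval a d n) n 1 (P n) \<and>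
          (\<forall>q. poly_sol (\<lambda>x. a * x ^ 2 + b * x + c) (\<lambda>x. d * x + e) (eigval a d n) n 1 q
               \<longrightarrow> q = P n))"

text \<open>In each family below, the arguments of \<open>eigval\<close> are the coefficient of \<open>x\<^sup>2\<close> in \<open>\<sigma>\<close> and
  that of \<open>x\<close> in \<open>\<tau>\<close>. The families are meaningful whenever there is exactly one
  polynomial solution of degree \<open>n\<close> with the given leading coefficient.\<close>

definition hahn_h_lc :: "complex \<Rightarrow> complex \<Rightarrow> nat \<Rightarrow> complex" where
  "hahn_h_lc \<alpha> \<beta> n = (\<alpha> + \<beta> + 2 * of_nat n) gchoose n"

definition hahn_h :: "complex \<Rightarrow> complex \<Rightarrow> complex \<Rightarrow> nat \<Rightarrow> complex poly" where
  "hahn_h \<alpha> \<beta> N n =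
     (THE p. poly_sol (\<lambda>x. x * (N + \<alpha> - x)) (\<lambda>x. (\<beta> + 1) * (N - 1) - (\<alpha> + \<beta> + 2) * x)
               (eigval (-1) (- (\<alpha> + \<beta> + 2)) n) n (hahn_h_lc \<alpha> \<beta> n) p)"

definition monic_hahn_h :: "complex \<Rightarrow> complex \<Rightarrow> complex \<Rightarrow> nat \<Rightarrow> complex poly" where
  "monic_hahn_h \<alpha> \<beta> N n = smult (1 / hahn_h_lc \<alpha> \<beta> n) (hahn_h \<alpha> \<beta> N n)"

definition cheb_t :: "complex \<Rightarrow> nat \<Rightarrow> complex poly" where
  "cheb_t N n = hahn_h 0 0 N n"

definition monic_cheb_t :: "complex \<Rightarrow> nat \<Rightarrow> complex poly" where
  "monic_cheb_t N n = smult (1 / hahn_h_lc 0 0 n) (cheb_t N n)"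

definition hahn_Q_lc :: "complex \<Rightarrow> complex \<Rightarrow> complex \<Rightarrow> nat \<Rightarrow> complex" where
  "hahn_Q_lc \<alpha> \<beta> N n =
     pochhammer (\<alpha> + \<beta> + of_nat n + 1) n / (pochhammer (- N) n * pochhammer (\<alpha> + 1) n)"

definition hahn_Q :: "complex \<Rightarrow> complex \<Rightarrow> complex \<Rightarrow> nat \<Rightarrow> complex poly" where
  "hahn_Q \<alpha> \<beta> N n =
     (THE p. poly_sol (\<lambda>x. x * (N + 1 + \<beta> - x)) (\<lambda>x. (\<alpha> + 1) * N - (\<alpha> + \<beta> + 2) * x)
               (eigval (-1) (- (\<alpha> + \<beta> + 2)) n) n (hahn_Q_lc \<alpha> \<beta> N n) p)"

definition monic_hahn_Q :: "complex \<Rightarrow> complex \<Rightarrow> complex \<Rightarrow> nat \<Rightarrow> complex poly" where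
  "monic_hahn_Q \<alpha> \<beta> N n = smult (1 / hahn_Q_lc \<alpha> \<beta> N n) (hahn_Q \<alpha> \<beta> N n)"

definition meixner_lc :: "complex \<Rightarrow> nat \<Rightarrow> complex" where
  "meixner_lc \<mu> n = (1 - 1 / \<mu>) ^ n"

definition meixner :: "complex \<Rightarrow> complex \<Rightarrow> nat \<Rightarrow> complex poly" where
  "meixner \<gamma> \<mu> n =
     (THE p. poly_sol (\<lambda>x. x) (\<lambda>x. \<gamma> * \<mu> - (1 - \<mu>) * x)
               (eigval 0 (- (1 - \<mu>)) n) n (meixner_lc \<mu> n) p)"

definition monic_meixner :: "complex \<Rightarrow> complex \<Rightarrow> nat \<Rightarrow> complex poly" where
  "monic_meixner \<gamma> \<mu> n = smult (1 / meixner_lc \<mu> n) (meixner \<gamma> \<mu> n)"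

definition krawtchouk_lc :: "nat \<Rightarrow> complex" where
  "krawtchouk_lc n = 1 / fact n"

definition krawtchouk :: "complex \<Rightarrow> complex \<Rightarrow> nat \<Rightarrow> complex poly" where
  "krawtchouk p N n =
     (THE y. poly_sol (\<lambda>x. x) (\<lambda>x. (N * p - x) / (1 - p))
               (eigval 0 (- (1 / (1 - p))) n) n (krawtchouk_lc n) y)"

definition monic_krawtchouk :: "complex \<Rightarrow> complex \<Rightarrow> nat \<Rightarrow> complex poly" where
  "monic_krawtchouk p N n = smult (1 / krawtchouk_lc n) (krawtchouk p N n)"

definition charlier_lc :: "complex \<Rightarrow> nat \<Rightarrow> complex" where
  "charlier_lc \<mu> n = (- 1 / \<mu>) ^ n"

definition charlier :: "complex \<Rightarrow> nat \<Rightarrow> complex poly" where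
  "charlier \<mu> n =
     (THE p. poly_sol (\<lambda>x. x) (\<lambda>x. \<mu> - x) (eigval 0 (-1) n) n (charlier_lc \<mu> n) p)"

definition monic_charlier :: "complex \<Rightarrow> nat \<Rightarrow> complex poly" where
  "monic_charlier \<mu> n = smult (1 / charlier_lc \<mu> n) (charlier \<mu> n)"

end

theory Submission
  imports Defs
begin

text \<open>
  Everything takes place in the basis of falling factorials
  \<open>\<phi>\<^sub>m(x) = x (x - 1) \<cdots> (x - m + 1)\<close>, in which \<open>\<Delta> \<phi>\<^sub>m = m \<phi>\<^sub>(m-1)\<close> and \<open>x \<nabla> \<phi>\<^sub>m = m \<phi>\<^sub>m\<close>.
  When \<open>c = 0\<close>, the coefficient \<open>\<sigma>(x) = x (a x + b)\<close> contains the factor \<open>x\<close> that this second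
  rule needs, and the difference operator is bidiagonal: it sends \<open>\<phi>\<^sub>m\<close> to a combination of \<open>\<phi>\<^sub>m\<close>
  and \<open>\<phi>\<^sub>(m-1)\<close> (\<open>operator_falling_sum\<close>). Comparing coefficients (\<open>falling_sum_eq_0D\<close>) gives the
  two-term recurrence. For general \<open>c\<close> the extra summand \<open>c \<Delta>\<nabla> y\<close> is expanded after replacing
  \<open>x\<close> by \<open>x + 1\<close>, since \<open>\<Delta>\<nabla> y (x + 1) = \<Delta>\<Delta> y (x)\<close>; the shift brings in one more neighbour and
  gives the three-term recurrence (\<open>diff_eq_falling_sum_shifted\<close>).

  The two-term recurrence reads
  \<open>(n - m) (a m + d + a n - a) C\<^sub>m = (m + 1) (a m\<^sup>2 + (b + d) m + e) C\<^sub>(m+1)\<close>.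
  So the ratio of consecutive coefficients is rational in \<open>m\<close>, and as \<open>(-x)\<^sub>m = (-1)\<^sup>m \<phi>\<^sub>m(x)\<close> the sum
  \<open>\<Sum> C\<^sub>m \<phi>\<^sub>m\<close> is a hypergeometric series whose lower parameters are read off from the factors of
  \<open>a m\<^sup>2 + (b + d) m + e\<close>. This is \<open>hypergeo_poly_sol\<close>, which treats all types of series at once;
  the constant in front is fixed by the leading coefficient. The recurrence, solved downwards from
  \<open>C\<^sub>n\<close>, also shows that the leading coefficient determines the solution, provided that no factor
  \<open>a m + d + a n - a\<close> with \<open>m < n\<close> vanishes (\<open>poly_sol_unique\<close>).
  Each representation then amounts to factoring one quadratic and comparing one constant.
\<close>

section \<open>Expansions in falling factorials\<close>

definition falling_sum :: "(nat \<Rightarrow> complex) \<Rightarrow> nat \<Rightarrow> complex \<Rightarrow> complex" where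
  "falling_sum C n x = (\<Sum>m\<le>n. C m * falling_fact x m)"

lemma falling_fact_0 [simp]: "falling_fact x 0 = 1"
  by (simp add: falling_fact_def)

lemma falling_fact_Suc: "falling_fact x (Suc m) = falling_fact x m * (x - of_nat m)"
  by (simp add: falling_fact_def)

lemma falling_fact_Suc_shift: "falling_fact (x + 1) (Suc m) = (x + 1) * falling_fact x m"
  by (induction m) (simp_all add: falling_fact_Suc)

lemma falling_fact_plus_one:
  "falling_fact (x + 1) (Suc m) = falling_fact x (Suc m) + of_nat (Suc m) * falling_fact x m"
  unfolding falling_fact_Suc_shift by (simp add: falling_fact_Suc algebra_simps)

lemma falling_fact_of_nat_eq_0: "j < m \<Longrightarrow> falling_fact (of_nat j) m = 0"
  by (auto simp: falling_fact_def)

lemma falling_fact_of_nat_self: "falling_fact (of_nat j) j \<noteq> 0"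
  by (auto simp: falling_fact_def)

lemma falling_fact_conv_pochhammer: "pochhammer (- x) m = (- 1) ^ m * falling_fact x m"
  by (induction m) (simp_all add: pochhammer_Suc falling_fact_Suc algebra_simps)

lemma sum_atMost_shift:
  fixes g :: "nat \<Rightarrow> 'a :: comm_monoid_add"
  assumes "g 0 = 0" "g (Suc n) = 0"
  shows "(\<Sum>m\<le>n. g m) = (\<Sum>m\<le>n. g (Suc m))"
  using sum.atMost_Suc[of g n] sum.atMost_Suc_shift[of g n] assms by simp

lemma falling_sum_plus_one:
  assumes "C (Suc n) = 0"
  shows "falling_sum C n (x + 1) = falling_sum (\<lambda>m. C m + of_nat (Suc m) * C (Suc m)) n x"
proof -
  define g where "g m = C m * (falling_fact (x + 1) m - falling_fact x m)" for m
  have "falling_sum C n (x + 1) = falling_sum C n x + (\<Sum>m\<le>n. g m)"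
    by (simp add: falling_sum_def g_def algebra_simps flip: sum.distrib)
  also have "(\<Sum>m\<le>n. g m) = (\<Sum>m\<le>n. g (Suc m))"
    by (rule sum_atMost_shift) (simp_all add: g_def assms)
  also have "falling_sum C n x + \<dots> = falling_sum (\<lambda>m. C m + of_nat (Suc m) * C (Suc m)) n x"
    unfolding falling_sum_def g_def falling_fact_plus_one
    by (simp add: algebra_simps sum.distrib)
  finally show ?thesis .
qed

lemma fwd_diff_falling_sum:
  assumes "C (Suc n) = 0"
  shows "\<Delta> (falling_sum C n) x = falling_sum (\<lambda>m. of_nat (Suc m) * C (Suc m)) n x"
  unfolding fwd_diff_def falling_sum_plus_one[of C n, OF assms]
  by (simp add: falling_sum_def algebra_simps sum.distrib)

text \<open>At \<open>x = j\<close> only the terms with index at most \<open>j\<close> survive, so evaluation at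
  \<open>0, 1, 2, \<dots>\<close> is a triangular system for the coefficients.\<close>

lemma falling_sum_eq_0D:
  assumes "\<And>x. falling_sum D n x = 0" and "j \<le> n"
  shows "D j = 0"
  using \<open>j \<le> n\<close>
proof (induction j rule: less_induct)
  case (less j)
  have "falling_sum D n (of_nat j) = (\<Sum>m\<in>{j}. D m * falling_fact (of_nat j) m)"
    unfolding falling_sum_def
  proof (rule sum.mono_neutral_right)
    show "\<forall>i\<in>{..n} - {j}. D i * falling_fact (of_nat j) i = 0"
    proof
      fix i assume i: "i \<in> {..n} - {j}"
      then consider "i < j" | "j < i" by force
      then show "D i * falling_fact (of_nat j) i = 0"
        using less.IH[of i] i by cases (auto simp: falling_fact_of_nat_eq_0)
    qed
  qed (use less.prems in auto)
  with assms(1) show ?case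
    by (simp add: falling_fact_of_nat_self)
qed

definition falling_poly :: "nat \<Rightarrow> complex poly" where
  "falling_poly m = (\<Prod>i<m. [:- of_nat i, 1:])"

lemma poly_falling_poly [simp]: "poly (falling_poly m) x = falling_fact x m"
  by (simp add: falling_poly_def falling_fact_def poly_prod)

lemma degree_falling_poly [simp]: "degree (falling_poly m) = m"
  unfolding falling_poly_def by (subst degree_prod_eq_sum_degree) auto

lemma coeff_falling_poly_self [simp]: "coeff (falling_poly m) m = 1"
proof -
  have "lead_coeff (falling_poly m) = 1"
    unfolding falling_poly_def lead_coeff_prod by simp
  then show ?thesis by simp
qed

lemma poly_falling_expansion:
  assumes "degree p \<le> n"
  obtains C where "\<And>m. m > n \<Longrightarrow> C m = 0" "poly p = falling_sum C n" "C n = coeff p n"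
proof -
  have "\<exists>C. (\<forall>m>n. C m = 0) \<and> poly p = falling_sum C n \<and> C n = coeff p n"
    using assms
  proof (induction n arbitrary: p)
    case 0
    then obtain u where "p = [:u:]" by (auto elim: degree_eq_zeroE)
    then show ?case
      by (intro exI[of _ "\<lambda>m. if m = 0 then u else 0"]) (auto simp: falling_sum_def)
  next
    case (Suc n)
    define q where "q = p - smult (coeff p (Suc n)) (falling_poly (Suc n))"
    have "degree q \<le> n"
    proof (rule degree_le, intro allI impI)
      fix i assume "n < i"
      then consider "i = Suc n" | "i > Suc n" by linarith
      then show "coeff q i = 0"
        using Suc.prems by cases (auto simp: q_def coeff_eq_0)
    qed
    then obtain C where C: "\<forall>m>n. C m = 0" "poly q = falling_sum C n"
      using Suc.IH by blast
    have "poly p x = poly q x + coeff p (Suc n) * falling_fact x (Suc n)" for x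
      by (simp add: q_def)
    then show ?case
      using C
      by (intro exI[of _ "C(Suc n := coeff p (Suc n))"]) (auto simp: falling_sum_def fun_eq_iff)
  qed
  then show thesis using that by blast
qed

lemma falling_sum_as_poly:
  assumes "C n \<noteq> 0"
  obtains p where "degree p = n" "lead_coeff p = C n" "poly p = falling_sum C n"
proof
  let ?p = "\<Sum>m\<le>n. smult (C m) (falling_poly m)"
  have "coeff ?p n = (\<Sum>m\<le>n. if m = n then C n else 0)"
    unfolding coeff_sum by (intro sum.cong) (auto simp: coeff_eq_0)
  then have coeff: "coeff ?p n = C n" by simp
  have "degree ?p \<le> n"
    by (rule degree_sum_le) (auto intro: order.trans[OF degree_smult_le])
  with coeff assms show deg: "degree ?p = n"
    by (metis le_degree order_antisym)
  show "lead_coeff ?p = C n" using coeff deg by simp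
  show "poly ?p = falling_sum C n"
    by (auto simp: falling_sum_def poly_sum)
qed

section \<open>The difference operator on falling factorials\<close>

text \<open>This is the coefficient of \<open>\<phi>\<^sub>m\<close> in the image of \<open>\<Sum> C m \<phi>\<^sub>m\<close> under
  \<open>(a x\<^sup>2 + b x) \<Delta>\<nabla> + (d x + e) \<Delta> + l\<close>, where \<open>\<phi>\<^sub>m(x)\<close> is the falling factorial.\<close>

definition image_coeff ::
  "complex \<Rightarrow> complex \<Rightarrow> complex \<Rightarrow> complex \<Rightarrow> complex \<Rightarrow> (nat \<Rightarrow> complex) \<Rightarrow> nat \<Rightarrow> complex" where
  "image_coeff a b d e l C m =
     (a * of_nat m * (of_nat m - 1) + d * of_nat m + l) * C m
     + (of_nat m + 1) * (a * of_nat m ^ 2 + (b + d) * of_nat m + e) * C (Suc m)"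

lemma fwd_bwd_diff: "\<Delta> (\<nabla> f) x = \<Delta> f x - \<Delta> f (x - 1)"
  by (simp add: fwd_diff_def bwd_diff_def)

lemma mult_falling_fact_bwd:
  "x * (falling_fact x m - falling_fact (x - 1) m) = of_nat m * falling_fact x m"
proof -
  have "x * falling_fact (x - 1) m = falling_fact x (Suc m)"
    using falling_fact_Suc_shift[of "x - 1" m] by simp
  then show ?thesis by (simp add: falling_fact_Suc algebra_simps)
qed

text \<open>With \<open>\<Delta> f = \<Sum> D m \<phi>\<^sub>m\<close>, the operator \<open>x \<nabla>\<close> multiplies \<open>\<phi>\<^sub>m\<close> by \<open>m\<close>, hence
  \<open>x \<Delta>\<nabla> f = \<Sum> m D m \<phi>\<^sub>m\<close>. The remaining factors \<open>a x + b\<close> and \<open>d x + e\<close> are absorbed by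
  \<open>x \<phi>\<^sub>m = \<phi>\<^sub>(m+1) + m \<phi>\<^sub>m\<close>. The summand \<open>c \<Delta>\<nabla> f\<close> lacks the factor \<open>x\<close> and is left alone.\<close>

lemma operator_falling_sum:
  fixes a b c d e l :: complex
  assumes "C (Suc n) = 0"
  defines "f \<equiv> falling_sum C n"
  shows "(a * x ^ 2 + b * x + c) * \<Delta> (\<nabla> f) x + (d * x + e) * \<Delta> f x + l * f x
       = falling_sum (image_coeff a b d e l C) n x + c * \<Delta> (\<nabla> f) x"
proof -
  define D where "D m = of_nat (Suc m) * C (Suc m)" for m
  have fD: "\<Delta> f = falling_sum D n"
    unfolding f_def D_def using fwd_diff_falling_sum[of C n] assms(1) by (simp add: fun_eq_iff)
  have x_diff: "x * \<Delta> (\<nabla> f) x = (\<Sum>m\<le>n. of_nat m * D m * falling_fact x m)"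
  proof -
    have "x * \<Delta> (\<nabla> f) x
        = (\<Sum>m\<le>n. D m * (x * (falling_fact x m - falling_fact (x - 1) m)))"
      unfolding fwd_bwd_diff fD falling_sum_def sum_subtractf[symmetric] sum_distrib_left
      by (intro sum.cong) (simp_all add: algebra_simps)
    also have "\<dots> = (\<Sum>m\<le>n. of_nat m * D m * falling_fact x m)"
      unfolding mult_falling_fact_bwd by (intro sum.cong) simp_all
    finally show ?thesis .
  qed
  \<comment> \<open>\<open>g (m + 1)\<close> is the part that multiplication by \<open>x\<close> moves from index \<open>m\<close> to \<open>m + 1\<close>.\<close>
  define g where "g m = (a * (of_nat m - 1) + d) * of_nat m * C m * falling_fact x m" for m
  have "(a * x ^ 2 + b * x) * \<Delta> (\<nabla> f) x + (d * x + e) * \<Delta> f x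
      = (a * x + b) * (x * \<Delta> (\<nabla> f) x) + (d * x + e) * \<Delta> f x"
    by (simp add: power2_eq_square algebra_simps)
  also have "\<dots> = (\<Sum>m\<le>n. (a * x + b) * (of_nat m * D m * falling_fact x m)
                       + (d * x + e) * (D m * falling_fact x m))"
    unfolding x_diff unfolding fD falling_sum_def sum_distrib_left sum.distrib ..
  also have "\<dots> = (\<Sum>m\<le>n. g (Suc m)
                 + (a * of_nat m ^ 2 + (b + d) * of_nat m + e) * D m * falling_fact x m)"
    by (intro sum.cong)
       (simp_all add: g_def D_def falling_fact_Suc power2_eq_square algebra_simps)
  also have "\<dots> = (\<Sum>m\<le>n. g m)
               + (\<Sum>m\<le>n. (a * of_nat m ^ 2 + (b + d) * of_nat m + e) * D m * falling_fact x m)"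
  proof -
    have "(\<Sum>m\<le>n. g m) = (\<Sum>m\<le>n. g (Suc m))"
      by (rule sum_atMost_shift) (simp_all add: g_def assms(1))
    then show ?thesis by (simp add: sum.distrib)
  qed
  finally have "(a * x ^ 2 + b * x) * \<Delta> (\<nabla> f) x + (d * x + e) * \<Delta> f x + l * f x
     = (\<Sum>m\<le>n. g m
         + (a * of_nat m ^ 2 + (b + d) * of_nat m + e) * D m * falling_fact x m
         + l * (C m * falling_fact x m))"
    unfolding f_def falling_sum_def sum_distrib_left sum.distrib by simp
  also have "\<dots> = falling_sum (image_coeff a b d e l C) n x"
    unfolding falling_sum_def
    by (intro sum.cong)
       (simp_all add: g_def D_def image_coeff_def power2_eq_square algebra_simps)
  finally show ?thesis by (simp add: algebra_simps)
qed

lemma diff_eq_falling_sum_iff: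
  assumes "C (Suc n) = 0"
  shows "diff_eq (\<lambda>x. a * x ^ 2 + b * x) (\<lambda>x. d * x + e) l (falling_sum C n)
     \<longleftrightarrow> (\<forall>m\<le>n. image_coeff a b d e l C m = 0)"
proof -
  have "diff_eq (\<lambda>x. a * x ^ 2 + b * x) (\<lambda>x. d * x + e) l (falling_sum C n)
     \<longleftrightarrow> (\<forall>x. falling_sum (image_coeff a b d e l C) n x = 0)"
    using operator_falling_sum[of C n a _ b 0 d e l] assms by (simp add: diff_eq_def)
  also have "\<dots> \<longleftrightarrow> (\<forall>m\<le>n. image_coeff a b d e l C m = 0)"
    using falling_sum_eq_0D[of "image_coeff a b d e l C" n] by (auto simp: falling_sum_def)
  finally show ?thesis .
qed

text \<open>For \<open>c \<noteq> 0\<close> the summand \<open>c \<Delta>\<nabla> f\<close> has no short expansion at \<open>x\<close>, but it has one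
  at \<open>x + 1\<close>, because \<open>\<Delta>\<nabla> f (x + 1) = \<Delta>\<Delta> f x\<close>. Shifting the other summands as well costs one
  neighbouring coefficient, which is why the recurrence has three terms.\<close>

lemma diff_eq_falling_sum_shifted:
  assumes "\<And>m. m > n \<Longrightarrow> C m = 0"
    and "diff_eq (\<lambda>x. a * x ^ 2 + b * x + c) (\<lambda>x. d * x + e) l (falling_sum C n)"
    and "m \<le> n"
  shows "image_coeff a b d e l C m + of_nat (Suc m) * image_coeff a b d e l C (Suc m)
     + c * (of_nat (Suc m) * of_nat (Suc (Suc m)) * C (Suc (Suc m))) = 0"
proof -
  let ?I = "image_coeff a b d e l C" and ?f = "falling_sum C n"
  define D where "D m = of_nat (Suc m) * C (Suc m)" for m
  have fD: "\<Delta> ?f = falling_sum D n"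
    unfolding D_def using fwd_diff_falling_sum[of C n] assms(1) by (simp add: fun_eq_iff)
  have "falling_sum (\<lambda>m. ?I m + of_nat (Suc m) * ?I (Suc m) + c * (of_nat (Suc m) * D (Suc m))) n x = 0"
    for x
  proof -
    have "\<Delta> (\<nabla> ?f) (x + 1) = \<Delta> (falling_sum D n) x"
      unfolding fwd_bwd_diff fD by (simp add: fwd_diff_def)
    also have "\<dots> = falling_sum (\<lambda>m. of_nat (Suc m) * D (Suc m)) n x"
      by (rule fwd_diff_falling_sum) (simp add: D_def assms(1))
    finally have *: "\<Delta> (\<nabla> ?f) (x + 1) = falling_sum (\<lambda>m. of_nat (Suc m) * D (Suc m)) n x" .
    have "0 = falling_sum ?I n (x + 1) + c * \<Delta> (\<nabla> ?f) (x + 1)"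
      using assms(2) operator_falling_sum[of C n a "x + 1" b c d e l] assms(1)
      by (simp add: diff_eq_def)
    also have "\<dots> = falling_sum (\<lambda>m. ?I m + of_nat (Suc m) * ?I (Suc m)) n x
                    + c * falling_sum (\<lambda>m. of_nat (Suc m) * D (Suc m)) n x"
      unfolding * by (subst falling_sum_plus_one) (simp_all add: image_coeff_def assms(1))
    finally show ?thesis
      by (simp add: falling_sum_def algebra_simps sum.distrib sum_distrib_left)
  qed
  from falling_sum_eq_0D[OF this \<open>m \<le> n\<close>] show ?thesis
    by (simp add: D_def algebra_simps)
qed

section \<open>Existence and uniqueness of polynomial solutions\<close>

lemma eigval_diff:
  "a * of_nat m * (of_nat m - 1) + d * of_nat m + eigval a d n
     = - ((of_nat n - of_nat m) * (a * of_nat m + d + a * of_nat n - a))"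
  by (simp add: eigval_def algebra_simps)

text \<open>The two-term recurrence determines the coefficients downwards from the leading one,
  as the factor of \<open>C m\<close> vanishes for no \<open>m < n\<close>.\<close>

lemma poly_sol_unique:
  assumes sol: "poly_sol (\<lambda>x. a * x ^ 2 + b * x) (\<lambda>x. d * x + e) (eigval a d n) n k p"
      "poly_sol (\<lambda>x. a * x ^ 2 + b * x) (\<lambda>x. d * x + e) (eigval a d n) n k q"
    and nz: "\<And>m. m < n \<Longrightarrow> a * of_nat m + d + a * of_nat n - a \<noteq> 0"
  shows "p = q"
proof -
  have ex: "\<exists>C. poly r = falling_sum C n \<and> C n = k \<and> (\<forall>m<n. (of_nat n - of_nat m) *
      (a * of_nat m + d + a * of_nat n - a) * C m =
      (of_nat m + 1) * (a * of_nat m ^ 2 + (b + d) * of_nat m + e) * C (Suc m))"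
    if r: "poly_sol (\<lambda>x. a * x ^ 2 + b * x) (\<lambda>x. d * x + e) (eigval a d n) n k r" for r
  proof -
    obtain C where C: "\<And>m. m > n \<Longrightarrow> C m = 0" "poly r = falling_sum C n" "C n = coeff r n"
      using poly_falling_expansion[of r n] r by (auto simp: poly_sol_def)
    have "diff_eq (\<lambda>x. a * x ^ 2 + b * x) (\<lambda>x. d * x + e) (eigval a d n) (falling_sum C n)"
      using r C(2) by (simp add: poly_sol_def)
    then have "\<forall>m\<le>n. image_coeff a b d e (eigval a d n) C m = 0"
      using diff_eq_falling_sum_iff[of C n] C(1) by simp
    moreover have "C n = k" using C(3) r by (auto simp: poly_sol_def)
    ultimately show ?thesis
      using C(2) unfolding image_coeff_def eigval_diff
      by (intro exI[of _ C]) (auto simp: add_eq_0_iff)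
  qed
  from ex[OF sol(1)] obtain C where C: "poly p = falling_sum C n" "C n = k"
      "\<And>m. m < n \<Longrightarrow> (of_nat n - of_nat m) * (a * of_nat m + d + a * of_nat n - a) * C m =
      (of_nat m + 1) * (a * of_nat m ^ 2 + (b + d) * of_nat m + e) * C (Suc m)" by blast
  from ex[OF sol(2)] obtain D where D: "poly q = falling_sum D n" "D n = k"
      "\<And>m. m < n \<Longrightarrow> (of_nat n - of_nat m) * (a * of_nat m + d + a * of_nat n - a) * D m =
      (of_nat m + 1) * (a * of_nat m ^ 2 + (b + d) * of_nat m + e) * D (Suc m)" by blast
  have "C m = D m" if "m \<le> n" for m
    using that
  proof (induction m rule: inc_induct)
    case base
    show ?case using C(2) D(2) by simp
  next
    case (step m)
    have "(of_nat n - of_nat m) * (a * of_nat m + d + a * of_nat n - a) \<noteq> 0"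
      using nz[of m] step.hyps by simp
    then show ?case
      using C(3)[of m] D(3)[of m] step by (metis mult_left_cancel)
  qed
  then have "poly p = poly q"
    unfolding C(1) D(1) by (auto simp: falling_sum_def fun_eq_iff)
  then show ?thesis by (simp add: poly_eq_poly_eq_iff)
qed

lemma hypergeo_falling_sum:
  "hypergeo (- of_nat n # - x # us) vs z =
     falling_sum (\<lambda>m. (- 1) ^ m * pochhammer (- of_nat n) m
       * prod_list (map (\<lambda>u. pochhammer u m) us) / prod_list (map (\<lambda>v. pochhammer v m) vs)
       * z ^ m / fact m) n x"
proof -
  have "hypergeo (- of_nat n # - x # us) vs z =
    (\<Sum>m\<le>n. prod_list (map (\<lambda>u. pochhammer u m) (- of_nat n # - x # us))
       / prod_list (map (\<lambda>v. pochhammer v m) vs) * z ^ m / fact m)"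
    unfolding hypergeo_def
    by (rule suminf_finite) (auto simp: pochhammer_of_nat_eq_0_iff)
  also have "\<dots> = (\<Sum>m\<le>n. (- 1) ^ m * pochhammer (- of_nat n) m
       * prod_list (map (\<lambda>u. pochhammer u m) us) / prod_list (map (\<lambda>v. pochhammer v m) vs)
       * z ^ m / fact m * falling_fact x m)"
    by (intro sum.cong) (simp_all add: falling_fact_conv_pochhammer[of x])
  finally show ?thesis by (simp add: falling_sum_def)
qed

lemma prod_list_pochhammer_Suc:
  "prod_list (map (\<lambda>u. pochhammer u (Suc m)) us) =
     prod_list (map (\<lambda>u. pochhammer u m) us) * prod_list (map (\<lambda>u. u + of_nat m) us)"
  for us :: "complex list"
  by (induction us) (simp_all add: pochhammer_Suc)

lemma pochhammer_self_minus: "(- 1) ^ n * pochhammer (- of_nat n :: complex) n = fact n"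
  by (simp add: pochhammer_same flip: power_mult_distrib)

text \<open>The term ratio of the series is a rational function of \<open>m\<close>, and the assumption \<open>ratio\<close>
  says that it is the ratio demanded by the two-term recurrence. This one criterion serves the
  \<open>\<^sub>3F\<^sub>2\<close>, \<open>\<^sub>2F\<^sub>1\<close> and \<open>\<^sub>2F\<^sub>0\<close> cases, which differ only in how \<open>a m\<^sup>2 + (b + d) m + e\<close> factors.
  The factor \<open>K\<close> normalises the leading coefficient to \<open>k\<close>.\<close>

lemma hypergeo_poly_sol:
  assumes ratio: "\<And>m. m < n \<Longrightarrow>
      (a * of_nat m ^ 2 + (b + d) * of_nat m + e) * (z * prod_list (map (\<lambda>u. u + of_nat m) us))
      = (a * of_nat m + d + a * of_nat n - a) * prod_list (map (\<lambda>v. v + of_nat m) vs)"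
    and vs: "\<And>v. v \<in> set vs \<Longrightarrow> pochhammer v n \<noteq> 0"
    and K: "K * prod_list (map (\<lambda>u. pochhammer u n) us) * z ^ n
      = k * prod_list (map (\<lambda>v. pochhammer v n) vs)"
    and k: "k \<noteq> 0"
  obtains p where
    "poly_sol (\<lambda>x. a * x ^ 2 + b * x) (\<lambda>x. d * x + e) (eigval a d n) n k p"
    "\<And>x. poly p x = K * hypergeo (- of_nat n # - x # us) vs z"
proof -
  define U where "U m = prod_list (map (\<lambda>u. pochhammer u m) us)" for m
  define V where "V m = prod_list (map (\<lambda>v. pochhammer v m) vs)" for m
  define C where "C m = K * ((- 1) ^ m * pochhammer (- of_nat n) m * U m / V m * z ^ m / fact m)"
    for m
  have "V m \<noteq> 0" if "m \<le> n" for m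
    using vs that by (force simp: V_def prod_list_zero_iff dest: pochhammer_neq_0_mono)
  note V_nz = this
  have "C n = K * U n * z ^ n / V n"
    using pochhammer_self_minus[of n] by (simp add: C_def)
  also have "\<dots> = k"
    using K V_nz[of n] by (simp add: U_def V_def field_simps)
  finally have Cn: "C n = k" .
  have C_gt: "C m = 0" if "m > n" for m
    using that by (simp add: C_def pochhammer_of_nat_eq_0_iff)
  have "image_coeff a b d e (eigval a d n) C m = 0" if "m \<le> n" for m
  proof (cases "m = n")
    case True
    then show ?thesis using C_gt by (simp add: image_coeff_def eigval_diff)
  next
    case False
    with that have "m < n" by simp
    define U' where "U' = prod_list (map (\<lambda>u. u + of_nat m) us)"
    define V' where "V' = prod_list (map (\<lambda>v. v + of_nat m) vs)"
    define q where "q = a * of_nat m ^ 2 + (b + d) * of_nat m + e"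
    define s where "s = a * of_nat m + d + a * of_nat n - a"
    have U_Suc: "U (Suc m) = U m * U'" and V_Suc: "V (Suc m) = V m * V'"
      unfolding U_def V_def U'_def V'_def by (rule prod_list_pochhammer_Suc)+
    with V_nz[of "Suc m"] \<open>m < n\<close> have "V m \<noteq> 0" "V' \<noteq> 0" by auto
    have "C (Suc m) = C m * ((of_nat n - of_nat m) * (U' / V' * z) / (of_nat m + 1))"
      unfolding C_def U_Suc V_Suc using \<open>V m \<noteq> 0\<close> \<open>V' \<noteq> 0\<close>
      by (simp add: pochhammer_Suc divide_simps) (simp add: algebra_simps)
    moreover have "of_nat m + 1 \<noteq> (0 :: complex)"
      using of_nat_neq_0[of m, where ?'a = complex] by (simp add: add.commute)
    ultimately have "(of_nat m + 1) * C (Suc m) = C m * ((of_nat n - of_nat m) * (U' / V' * z))"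
      by simp
    then have "(of_nat m + 1) * q * C (Suc m) = C m * (of_nat n - of_nat m) * (q * (z * U') / V')"
      by (simp add: mult_ac)
    also have "q * (z * U') / V' = s"
      using ratio[OF \<open>m < n\<close>] \<open>V' \<noteq> 0\<close> by (simp add: q_def s_def U'_def V'_def)
    finally show ?thesis
      unfolding image_coeff_def eigval_diff q_def s_def by (simp add: algebra_simps)
  qed
  then have "diff_eq (\<lambda>x. a * x ^ 2 + b * x) (\<lambda>x. d * x + e) (eigval a d n) (falling_sum C n)"
    using diff_eq_falling_sum_iff[of C n] C_gt by simp
  moreover obtain p where "degree p = n" "lead_coeff p = C n" "poly p = falling_sum C n"
    using falling_sum_as_poly[of C n] Cn k by auto
  moreover have "falling_sum C n x = K * hypergeo (- of_nat n # - x # us) vs z" for x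
    unfolding hypergeo_falling_sum falling_sum_def C_def U_def V_def sum_distrib_left
    by (intro sum.cong) simp_all
  ultimately show thesis
    using that[of p] Cn by (simp add: poly_sol_def)
qed

text \<open>The classical families are given by a description operator, so that computing them takes
  both the hypergeometric solution and uniqueness, which is why \<open>nz\<close> is assumed.\<close>

lemma poly_the_sol_hypergeo:
  assumes \<sigma>: "\<sigma> = (\<lambda>x. a * x ^ 2 + b * x)" and \<tau>: "\<tau> = (\<lambda>x. d * x + e)"
    and ratio: "\<And>m. m < n \<Longrightarrow>
      (a * of_nat m ^ 2 + (b + d) * of_nat m + e) * (z * prod_list (map (\<lambda>u. u + of_nat m) us))
      = (a * of_nat m + d + a * of_nat n - a) * prod_list (map (\<lambda>v. v + of_nat m) vs)"
    and vs: "\<And>v. v \<in> set vs \<Longrightarrow> pochhammer v n \<noteq> 0"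
    and K: "K * prod_list (map (\<lambda>u. pochhammer u n) us) * z ^ n
      = k * prod_list (map (\<lambda>v. pochhammer v n) vs)"
    and k: "k \<noteq> 0"
    and nz: "\<And>m. m < n \<Longrightarrow> a * of_nat m + d + a * of_nat n - a \<noteq> 0"
  shows "poly (THE p. poly_sol \<sigma> \<tau> (eigval a d n) n k p) x
       = K * hypergeo (- of_nat n # - x # us) vs z"
proof -
  obtain p where p: "poly_sol \<sigma> \<tau> (eigval a d n) n k p"
      "\<And>x. poly p x = K * hypergeo (- of_nat n # - x # us) vs z"
    using hypergeo_poly_sol[OF ratio vs K k] unfolding \<sigma> \<tau> by blast
  have "(THE p. poly_sol \<sigma> \<tau> (eigval a d n) n k p) = p"
    using p(1) poly_sol_unique nz unfolding \<sigma> \<tau> by (intro the_equality) blast+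
  with p(2) show ?thesis by simp
qed

section \<open>The monic system\<close>

lemma monic_system_three_term:
  assumes sys: "monic_system a b c d e P"
    and C: "\<And>n x. poly (P n) x = (\<Sum>m\<le>n. C m n * falling_fact x m)"
      "\<And>n m. m > n \<Longrightarrow> C m n = 0"
  shows "(a * of_nat n + a * of_nat m - a + d) * (of_nat n - of_nat m) * C m n
            + (of_nat m + 1)
              * (a * of_nat n ^ 2 - 2 * a * of_nat m ^ 2 - a * of_nat n - a * of_nat m
                 + of_nat n * d - 2 * d * of_nat m - b * of_nat m - d - e) * C (m + 1) n
            - (of_nat m + 1) * (of_nat m + 2)
              * (a * of_nat m ^ 2 + 2 * a * of_nat m + d * of_nat m + b * of_nat m
                 + a + d + b + c + e) * C (m + 2) n = 0" (is "?lhs = 0")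
proof (cases "m \<le> n")
  case True
  have "poly (P n) = falling_sum (\<lambda>m. C m n) n"
    using C(1) by (auto simp: falling_sum_def)
  moreover have "diff_eq (\<lambda>x. a * x ^ 2 + b * x + c) (\<lambda>x. d * x + e) (eigval a d n) (poly (P n))"
    using sys by (simp add: monic_system_def poly_sol_def)
  ultimately have "diff_eq (\<lambda>x. a * x ^ 2 + b * x + c) (\<lambda>x. d * x + e) (eigval a d n)
      (falling_sum (\<lambda>m. C m n) n)" by simp
  note rec = diff_eq_falling_sum_shifted[OF C(2) this True]
  have "?lhs = - (image_coeff a b d e (eigval a d n) (\<lambda>m. C m n) m
      + of_nat (Suc m) * image_coeff a b d e (eigval a d n) (\<lambda>m. C m n) (Suc m)
      + c * (of_nat (Suc m) * of_nat (Suc (Suc m)) * C (Suc (Suc m)) n))"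
    unfolding image_coeff_def eigval_def of_nat_Suc Suc_eq_plus1[symmetric] add_2_eq_Suc'
    by algebra
  then show ?thesis by (simp only: rec minus_zero)
qed (simp add: C(2))

lemma monic_system_two_term:
  assumes sys: "monic_system a b 0 d e P"
    and C: "\<And>n x. poly (P n) x = (\<Sum>m\<le>n. C m n * falling_fact x m)"
      "\<And>n m. m > n \<Longrightarrow> C m n = 0"
  shows "(of_nat n - of_nat m) * (a * of_nat m + d + a * of_nat n - a) * C m n
            - (of_nat m + 1)
              * (a * of_nat m ^ 2 + of_nat m * b + of_nat m * d + e) * C (m + 1) n = 0"
proof (cases "m \<le> n")
  case True
  have "poly (P n) = falling_sum (\<lambda>m. C m n) n"
    using C(1) by (auto simp: falling_sum_def)
  moreover have "diff_eq (\<lambda>x. a * x ^ 2 + b * x) (\<lambda>x. d * x + e) (eigval a d n) (poly (P n))"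
    using sys by (simp add: monic_system_def poly_sol_def)
  ultimately have "diff_eq (\<lambda>x. a * x ^ 2 + b * x) (\<lambda>x. d * x + e) (eigval a d n)
      (falling_sum (\<lambda>m. C m n) n)" by simp
  then have "image_coeff a b d e (eigval a d n) (\<lambda>m. C m n) m = 0"
    using diff_eq_falling_sum_iff[of "\<lambda>m. C m n" n] C(2) True by simp
  then show ?thesis
    unfolding image_coeff_def eigval_diff Suc_eq_plus1 by algebra
qed (simp add: C(2))

text \<open>For \<open>a = d = 0\<close> constants are annihilated by the operator, so that \<open>P 1 + 1\<close> would be a
  second monic solution of degree 1.\<close>

lemma monic_system_d_nonzero:
  assumes sys: "monic_system 0 b c d e P"
  shows "d \<noteq> 0"
proof
  assume "d = 0"
  let ?sol = "poly_sol (\<lambda>x. 0 * x ^ 2 + b * x + c) (\<lambda>x. d * x + e) (eigval 0 d 1) 1 1"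
  have P: "?sol (P 1)" and unique: "\<And>q. ?sol q \<Longrightarrow> q = P 1"
    using sys unfolding monic_system_def by blast+
  from P have "degree (P 1) = 1" "lead_coeff (P 1) = 1" by (auto simp: poly_sol_def)
  then have deg: "degree (P 1 + 1) = 1" "lead_coeff (P 1 + 1) = 1"
    by (simp_all add: degree_add_eq_left)
  have "diff_eq (\<lambda>x. 0 * x ^ 2 + b * x + c) (\<lambda>x. d * x + e) (eigval 0 d 1) (poly (P 1 + 1))"
    using P \<open>d = 0\<close>
    by (simp add: poly_sol_def diff_eq_def fwd_diff_def bwd_diff_def eigval_def)
  with deg have "?sol (P 1 + 1)" by (simp add: poly_sol_def)
  from unique[OF this] show False by simp
qed

text \<open>Uniqueness is part of the notion of a monic system, so exhibiting the hypergeometric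
  solution suffices.\<close>

lemma monic_system_hypergeo:
  assumes sys: "monic_system a b 0 d e P"
    and ratio: "\<And>m. m < n \<Longrightarrow>
      (a * of_nat m ^ 2 + (b + d) * of_nat m + e) * (z * prod_list (map (\<lambda>u. u + of_nat m) us))
      = (a * of_nat m + d + a * of_nat n - a) * prod_list (map (\<lambda>v. v + of_nat m) vs)"
    and vs: "\<And>v. v \<in> set vs \<Longrightarrow> pochhammer v n \<noteq> 0"
    and K: "K * prod_list (map (\<lambda>u. pochhammer u n) us) * z ^ n
      = prod_list (map (\<lambda>v. pochhammer v n) vs)"
  shows "poly (P n) x = K * hypergeo (- of_nat n # - x # us) vs z"
proof -
  obtain p where p: "poly_sol (\<lambda>x. a * x ^ 2 + b * x) (\<lambda>x. d * x + e) (eigval a d n) n 1 p"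
      "\<And>x. poly p x = K * hypergeo (- of_nat n # - x # us) vs z"
    using hypergeo_poly_sol[OF ratio vs, where K = K and k = 1] K by auto
  have "p = P n" using sys p(1) by (auto simp: monic_system_def)
  with p(2) show ?thesis by simp
qed

text \<open>The duplication formula in the form
  \<open>(u)\<^sub>n (u + n)\<^sub>n = 4\<^sup>n ((u + 1)/2)\<^sub>n (u/2)\<^sub>n\<close> accounts for the denominators below.\<close>

lemma pochhammer_duplication:
  fixes u :: complex
  shows "pochhammer u n * pochhammer (u + of_nat n) n
       = 4 ^ n * (pochhammer ((u + 1) / 2) n * pochhammer (u / 2) n)"
proof -
  have "pochhammer u n * pochhammer (u + of_nat n) n = pochhammer u (n + n)"
    by (rule pochhammer_product'[symmetric])
  also have "\<dots> = pochhammer (2 * (u / 2)) (2 * n)"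
    by (simp flip: mult_2)
  also have "\<dots> = of_nat (2 ^ (2 * n)) * pochhammer (u / 2) n * pochhammer (u / 2 + 1 / 2) n"
    by (rule pochhammer_double)
  also have "of_nat (2 ^ (2 * n)) = (4 ^ n :: complex)"
    by (simp add: power_mult)
  also have "u / 2 + 1 / 2 = (u + 1) / 2"
    by (rule add_divide_distrib[symmetric])
  finally show ?thesis by (simp only: mult_ac)
qed

text \<open>The numbers \<open>-rp\<close> and \<open>-rm\<close> are the zeros of \<open>a y\<^sup>2 + (b + d) y + e\<close>, whose factorisation
  supplies the two lower parameters.\<close>

lemma monic_system_3F2:
  fixes a b d e :: complex
  defines "s \<equiv> csqrt ((b + d) ^ 2 - 4 * a * e)"
  defines "rp \<equiv> (b + d + s) / (2 * a)" and "rm \<equiv> (b + d - s) / (2 * a)"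
  assumes sys: "monic_system a b 0 d e P" and a: "a \<noteq> 0"
    and nz: "pochhammer rp n \<noteq> 0" "pochhammer rm n \<noteq> 0"
      "pochhammer (d / (2 * a)) n \<noteq> 0" "pochhammer ((d - a) / (2 * a)) n \<noteq> 0"
  shows "poly (P n) x =
    pochhammer (d / a - 1) n * pochhammer rp n * pochhammer rm n
      / (pochhammer (d / (2 * a)) n * pochhammer ((d - a) / (2 * a)) n) * (1 / 4) ^ n
    * hypergeo [- of_nat n, - x, of_nat n - 1 + d / a] [rp, rm] 1"
proof (rule monic_system_hypergeo[OF sys])
  have "s ^ 2 = (b + d) ^ 2 - 4 * a * e" by (simp add: s_def)
  then have "(b + d + s) * (b + d - s) = 4 * a * e"
    by (simp add: algebra_simps power2_eq_square)
  then have prod: "rp * rm = e / a"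
    using a by (simp add: rp_def rm_def)
  have sum: "rp + rm = (b + d) / a"
    using a by (simp add: rp_def rm_def field_simps)
  have fac: "a * y ^ 2 + (b + d) * y + e = a * ((rp + y) * (rm + y))" for y
  proof -
    have "a * ((rp + y) * (rm + y)) = a * y ^ 2 + a * (rp + rm) * y + a * (rp * rm)"
      by (simp add: algebra_simps power2_eq_square)
    then show ?thesis using a by (simp add: prod sum)
  qed
  show "(a * of_nat m ^ 2 + (b + d) * of_nat m + e)
          * (1 * prod_list (map (\<lambda>u. u + of_nat m) [of_nat n - 1 + d / a]))
      = (a * of_nat m + d + a * of_nat n - a) * prod_list (map (\<lambda>v. v + of_nat m) [rp, rm])" for m
    unfolding fac using a by (simp add: field_simps)
  show "pochhammer v n \<noteq> 0" if "v \<in> set [rp, rm]" for v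
    using that nz by auto
  define u where "u = d / a - 1"
  have u: "d / (2 * a) = (u + 1) / 2" "(d - a) / (2 * a) = u / 2"
    "of_nat n - 1 + d / a = u + of_nat n"
    using a by (simp_all add: u_def field_simps)
  have "pochhammer u n * pochhammer (u + of_nat n) n
      / (pochhammer ((u + 1) / 2) n * pochhammer (u / 2) n) * (1 / 4) ^ n = 1"
    using nz(3,4) unfolding pochhammer_duplication u by (simp add: power_one_over)
  then have "pochhammer rp n * pochhammer rm n
      = (pochhammer u n * pochhammer (u + of_nat n) n
         / (pochhammer ((u + 1) / 2) n * pochhammer (u / 2) n) * (1 / 4) ^ n)
        * (pochhammer rp n * pochhammer rm n)" by simp
  then show "pochhammer (d / a - 1) n * pochhammer rp n * pochhammer rm n
      / (pochhammer (d / (2 * a)) n * pochhammer ((d - a) / (2 * a)) n) * (1 / 4) ^ n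
      * prod_list (map (\<lambda>u. pochhammer u n) [of_nat n - 1 + d / a]) * 1 ^ n
    = prod_list (map (\<lambda>v. pochhammer v n) [rp, rm])"
    unfolding u_def[symmetric] u by (simp add: mult_ac)
qed

text \<open>For \<open>a = 0\<close> the quadratic degenerates to \<open>(b + d) (m + e / (b + d))\<close>, which leaves one lower
  parameter and moves the quotient \<open>d / (b + d)\<close> into the argument; for \<open>d = -b\<close> it is the
  constant \<open>e\<close>, so that no lower parameter remains.\<close>

lemma monic_system_2F1:
  assumes sys: "monic_system 0 b 0 d e P" and bd: "b + d \<noteq> 0"
    and nz: "pochhammer (e / (b + d)) n \<noteq> 0"
  shows "poly (P n) x = pochhammer (e / (b + d)) n * (1 + b / d) ^ n
              * hypergeo [- of_nat n, - x] [e / (b + d)] (d / (b + d))"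
proof (rule monic_system_hypergeo[OF sys])
  have d: "d \<noteq> 0" using monic_system_d_nonzero[OF sys] .
  have "1 + b / d = (b + d) / d"
    using d by (simp add: field_simps)
  with d bd have inv: "(1 + b / d) * (d / (b + d)) = 1" by simp
  have inv_power: "(1 + b / d) ^ n * (d / (b + d)) ^ n = 1"
    unfolding power_mult_distrib[symmetric] inv by simp
  show "(0 * of_nat m ^ 2 + (b + d) * of_nat m + e)
          * (d / (b + d) * prod_list (map (\<lambda>u. u + of_nat m) []))
      = (0 * of_nat m + d + 0 * of_nat n - 0)
          * prod_list (map (\<lambda>v. v + of_nat m) [e / (b + d)])" for m
    using bd by (simp add: field_simps)
  show "pochhammer v n \<noteq> 0" if "v \<in> set [e / (b + d)]" for v
    using that nz by auto
  show "pochhammer (e / (b + d)) n * (1 + b / d) ^ n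
      * prod_list (map (\<lambda>u. pochhammer u n) []) * (d / (b + d)) ^ n
    = prod_list (map (\<lambda>v. pochhammer v n) [e / (b + d)])"
    using inv_power by simp
qed

lemma monic_system_2F0:
  assumes sys: "monic_system 0 b 0 (- b) e P" and e: "e \<noteq> 0"
  shows "poly (P n) x = (- e / b) ^ n * hypergeo [- of_nat n, - x] [] (- b / e)"
proof (rule monic_system_hypergeo[OF sys])
  have inv: "(- e / b) * (- b / e) = 1"
    using monic_system_d_nonzero[OF sys] e by simp
  show "(- e / b) ^ n * prod_list (map (\<lambda>u. pochhammer u n) []) * (- b / e) ^ n
      = prod_list (map (\<lambda>v. pochhammer v n) [])"
    using arg_cong[OF inv, of "\<lambda>t. t ^ n"] by (simp only: power_mult_distrib) simp
qed (use e in auto)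

section \<open>The classical families\<close>

lemma pochhammer_reflect:
  fixes N :: complex
  shows "pochhammer (N - of_nat n) n = (- 1) ^ n * pochhammer (1 - N) n"
  using pochhammer_minus[of "N - 1" n] by (simp flip: power_mult_distrib mult.assoc)

lemma hahn_eigval_nonzero:
  fixes s :: complex
  assumes "pochhammer (of_nat n + 1 + s) n \<noteq> 0" "m < n"
  shows "- 1 * of_nat m + - (s + 2) + - 1 * of_nat n - - 1 \<noteq> 0"
proof
  assume "- 1 * of_nat m + - (s + 2) + - 1 * of_nat n - - 1 = 0"
  then have "of_nat n + 1 + s = - of_nat m"
    by (simp add: algebra_simps eq_neg_iff_add_eq_0 add_eq_0_iff)
  with assms show False by (auto simp: pochhammer_eq_0_iff)
qed

lemma hahn_h_lc_pochhammer:
  "hahn_h_lc \<alpha> \<beta> n = pochhammer (of_nat n + 1 + \<alpha> + \<beta>) n / fact n"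
  by (simp add: hahn_h_lc_def gbinomial_pochhammer' algebra_simps)

text \<open>Here \<open>a m\<^sup>2 + (b + d) m + e\<close> is \<open>-(m + \<beta> + 1) (m + 1 - N)\<close>.\<close>

lemma hahn_h_hypergeo:
  assumes nz: "pochhammer (of_nat n + 1 + \<alpha> + \<beta>) n \<noteq> 0" "pochhammer (\<beta> + 1) n \<noteq> 0"
    "pochhammer (1 - N) n \<noteq> 0"
  shows "poly (hahn_h \<alpha> \<beta> N n) x =
      (- 1) ^ n / fact n * pochhammer (\<beta> + 1) n * pochhammer (N - of_nat n) n
      * hypergeo [- of_nat n, - x, of_nat n + 1 + \<alpha> + \<beta>] [\<beta> + 1, 1 - N] 1"
  unfolding hahn_h_def
proof (rule poly_the_sol_hypergeo[where b = "N + \<alpha>" and e = "(\<beta> + 1) * (N - 1)"])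
  show "- 1 * of_nat m + - (\<alpha> + \<beta> + 2) + - 1 * of_nat n - - 1 \<noteq> 0" if "m < n" for m
    using hahn_eigval_nonzero[of n "\<alpha> + \<beta>" m] nz that by (simp add: add.assoc)
  show "pochhammer v n \<noteq> 0" if "v \<in> set [\<beta> + 1, 1 - N]" for v
    using that nz by auto
  show "(- 1) ^ n / fact n * pochhammer (\<beta> + 1) n * pochhammer (N - of_nat n) n
      * prod_list (map (\<lambda>u. pochhammer u n) [of_nat n + 1 + \<alpha> + \<beta>]) * 1 ^ n
    = hahn_h_lc \<alpha> \<beta> n * prod_list (map (\<lambda>v. pochhammer v n) [\<beta> + 1, 1 - N])"
    by (simp add: hahn_h_lc_pochhammer pochhammer_reflect mult_ac)
qed (use nz in \<open>auto simp: hahn_h_lc_pochhammer power2_eq_square algebra_simps\<close>)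

lemma monic_hahn_h_hypergeo:
  assumes nz: "pochhammer (of_nat n + 1 + \<alpha> + \<beta>) n \<noteq> 0" "pochhammer (\<beta> + 1) n \<noteq> 0"
    "pochhammer (1 - N) n \<noteq> 0"
  shows "poly (monic_hahn_h \<alpha> \<beta> N n) x =
      pochhammer (1 + \<beta>) n * pochhammer (1 - N) n / pochhammer (1 + of_nat n + \<alpha> + \<beta>) n
      * hypergeo [- of_nat n, - x, of_nat n + 1 + \<alpha> + \<beta>] [\<beta> + 1, 1 - N] 1"
  unfolding monic_hahn_h_def poly_smult hahn_h_hypergeo[OF nz] hahn_h_lc_pochhammer
  using nz(1) by (simp add: pochhammer_reflect add.commute[of \<beta>] add.commute[of "of_nat n"]
      flip: power_mult_distrib)

text \<open>Here \<open>(n + 1)\<^sub>n = (2 n)! / n! = 4\<^sup>n (1/2)\<^sub>n\<close> is the duplication formula at \<open>u = 1\<close>.\<close>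

lemma pochhammer_Suc_self: "pochhammer (of_nat n + 1 :: complex) n = pochhammer (1 / 2) n * 4 ^ n"
  using pochhammer_duplication[of 1 n]
  by (simp add: pochhammer_fact[symmetric] add.commute mult.commute)

lemma pochhammer_Suc_self_nonzero: "pochhammer (of_nat n + 1 :: complex) n \<noteq> 0"
proof
  assume "pochhammer (of_nat n + 1 :: complex) n = 0"
  then obtain k where "of_nat n + 1 = - (of_nat k :: complex)"
    by (auto simp: pochhammer_eq_0_iff)
  then have "(of_nat n + 1) + of_nat k = (0 :: complex)" by simp
  then have "of_nat (Suc (n + k)) = (0 :: complex)" by (simp add: add_ac)
  then show False unfolding of_nat_eq_0_iff by simp
qed

lemma cheb_t_hypergeo:
  assumes "pochhammer (1 - N) n \<noteq> 0"
  shows "poly (cheb_t N n) x =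
      (- 1) ^ n * pochhammer (N - of_nat n) n
      * hypergeo [- of_nat n, - x, of_nat n + 1] [1, 1 - N] 1"
    and "poly (monic_cheb_t N n) x =
      fact n * pochhammer (1 - N) n / (pochhammer (1 / 2) n * 4 ^ n)
      * hypergeo [- of_nat n, - x, of_nat n + 1] [1, 1 - N] 1"
proof -
  have nz: "pochhammer (of_nat n + 1 + 0 + 0 :: complex) n \<noteq> 0" "pochhammer (0 + 1 :: complex) n \<noteq> 0"
    using pochhammer_Suc_self_nonzero by (simp_all add: pochhammer_fact[symmetric])
  show "poly (cheb_t N n) x =
      (- 1) ^ n * pochhammer (N - of_nat n) n
      * hypergeo [- of_nat n, - x, of_nat n + 1] [1, 1 - N] 1"
    unfolding cheb_t_def hahn_h_hypergeo[OF nz assms]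
    by (simp add: pochhammer_fact[symmetric])
  have "monic_cheb_t N n = monic_hahn_h 0 0 N n"
    by (simp add: monic_cheb_t_def cheb_t_def monic_hahn_h_def)
  then show "poly (monic_cheb_t N n) x =
      fact n * pochhammer (1 - N) n / (pochhammer (1 / 2) n * 4 ^ n)
      * hypergeo [- of_nat n, - x, of_nat n + 1] [1, 1 - N] 1"
    using monic_hahn_h_hypergeo[OF nz assms, of x]
    by (simp add: pochhammer_fact[symmetric] pochhammer_Suc_self add.commute[of 1])
qed

text \<open>Here \<open>a m\<^sup>2 + (b + d) m + e\<close> is \<open>-(m + \<alpha> + 1) (m - N)\<close>: it is the one of \<open>hahn_h\<close> with \<open>\<alpha>\<close> and \<open>\<beta>\<close>
  exchanged and \<open>N + 1\<close> for \<open>N\<close>, and so the monic polynomials agree under this substitution.\<close>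

lemma hahn_Q_hypergeo:
  assumes nz: "pochhammer (of_nat n + 1 + \<alpha> + \<beta>) n \<noteq> 0" "pochhammer (\<alpha> + 1) n \<noteq> 0"
    "pochhammer (- N) n \<noteq> 0"
  shows "poly (hahn_Q \<alpha> \<beta> N n) x =
      hypergeo [- of_nat n, - x, of_nat n + 1 + \<alpha> + \<beta>] [\<alpha> + 1, - N] 1"
proof -
  have lc: "hahn_Q_lc \<alpha> \<beta> N n =
      pochhammer (of_nat n + 1 + \<alpha> + \<beta>) n / (pochhammer (- N) n * pochhammer (\<alpha> + 1) n)"
    by (simp add: hahn_Q_lc_def algebra_simps)
  have "poly (hahn_Q \<alpha> \<beta> N n) x =
      1 * hypergeo [- of_nat n, - x, of_nat n + 1 + \<alpha> + \<beta>] [\<alpha> + 1, - N] 1"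
    unfolding hahn_Q_def
  proof (rule poly_the_sol_hypergeo[where b = "N + 1 + \<beta>" and e = "(\<alpha> + 1) * N"])
    show "- 1 * of_nat m + - (\<alpha> + \<beta> + 2) + - 1 * of_nat n - - 1 \<noteq> 0" if "m < n" for m
      using hahn_eigval_nonzero[of n "\<alpha> + \<beta>" m] nz that by (simp add: add.assoc)
  qed (use nz in \<open>auto simp: lc power2_eq_square algebra_simps\<close>)
  then show ?thesis by simp
qed

lemma monic_hahn_Q_eq_monic_hahn_h:
  assumes nz: "pochhammer (of_nat n + 1 + \<alpha> + \<beta>) n \<noteq> 0" "pochhammer (\<alpha> + 1) n \<noteq> 0"
    "pochhammer (- N) n \<noteq> 0"
  shows "poly (monic_hahn_Q \<alpha> \<beta> N n) x = poly (monic_hahn_h \<beta> \<alpha> (N + 1) n) x"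
proof -
  have swap: "of_nat n + 1 + \<beta> + \<alpha> = of_nat n + 1 + \<alpha> + \<beta>" by simp
  have "poly (monic_hahn_h \<beta> \<alpha> (N + 1) n) x
      = pochhammer (1 + \<alpha>) n * pochhammer (1 - (N + 1)) n / pochhammer (1 + of_nat n + \<beta> + \<alpha>) n
        * hypergeo [- of_nat n, - x, of_nat n + 1 + \<beta> + \<alpha>] [\<alpha> + 1, 1 - (N + 1)] 1"
    by (rule monic_hahn_h_hypergeo) (use nz in \<open>simp_all only: swap, simp_all\<close>)
  moreover have "poly (monic_hahn_Q \<alpha> \<beta> N n) x
      = 1 / hahn_Q_lc \<alpha> \<beta> N n
        * hypergeo [- of_nat n, - x, of_nat n + 1 + \<alpha> + \<beta>] [\<alpha> + 1, - N] 1"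
    unfolding monic_hahn_Q_def poly_smult hahn_Q_hypergeo[OF nz] ..
  ultimately show ?thesis
    by (simp add: hahn_Q_lc_def swap) (simp add: algebra_simps)
qed

text \<open>The remaining families have \<open>a = 0\<close>. The linear polynomial \<open>(b + d) m + e\<close> is
  \<open>\<mu> (m + \<gamma>)\<close> for Meixner, \<open>- p (m - N) / (1 - p)\<close> for Krawtchouk and the constant \<open>\<mu>\<close> for
  Charlier.\<close>

lemma meixner_hypergeo:
  assumes "\<mu> \<noteq> 0" "\<mu> \<noteq> 1" "pochhammer \<gamma> n \<noteq> 0"
  shows "poly (meixner \<gamma> \<mu> n) x =
      pochhammer \<gamma> n * hypergeo [- of_nat n, - x] [\<gamma>] (1 - 1 / \<mu>)"
  unfolding meixner_def
  by (rule poly_the_sol_hypergeo[where b = 1 and e = "\<gamma> * \<mu>"])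
     (use assms in \<open>auto simp: meixner_lc_def field_simps\<close>)

lemma monic_meixner_hypergeo:
  assumes "\<mu> \<noteq> 0" "\<mu> \<noteq> 1" "pochhammer \<gamma> n \<noteq> 0"
  shows "poly (monic_meixner \<gamma> \<mu> n) x =
      pochhammer \<gamma> n * (\<mu> / (\<mu> - 1)) ^ n * hypergeo [- of_nat n, - x] [\<gamma>] (1 - 1 / \<mu>)"
proof -
  have "1 / (1 - 1 / \<mu>) = \<mu> / (\<mu> - 1)" using assms by (simp add: field_simps)
  then have "1 / meixner_lc \<mu> n = (\<mu> / (\<mu> - 1)) ^ n"
    unfolding meixner_lc_def by (metis power_one_over)
  then show ?thesis
    unfolding monic_meixner_def poly_smult meixner_hypergeo[OF assms] by simp
qed

lemma krawtchouk_hypergeo: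
  assumes "p \<noteq> 0" "p \<noteq> 1" "pochhammer (- N) n \<noteq> 0"
  shows "poly (krawtchouk p N n) x =
      (- 1) ^ n * (N gchoose n) * p ^ n * hypergeo [- of_nat n, - x] [- N] (1 / p)"
  unfolding krawtchouk_def
proof (rule poly_the_sol_hypergeo[where b = 1 and e = "N * p / (1 - p)"])
  show "(\<lambda>x. (N * p - x) / (1 - p)) = (\<lambda>x. - (1 / (1 - p)) * x + N * p / (1 - p))"
    by (simp add: fun_eq_iff diff_divide_distrib)
  define w where "w = 1 / (1 - p)"
  have w: "1 + - w = - (p * w)" and e: "N * p / (1 - p) = N * p * w"
    using assms by (simp_all add: w_def field_simps)
  show "(0 * of_nat m ^ 2 + (1 + - (1 / (1 - p))) * of_nat m + N * p / (1 - p))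
        * (1 / p * prod_list (map (\<lambda>u. u + of_nat m) []))
      = (0 * of_nat m + - (1 / (1 - p)) + 0 * of_nat n - 0)
        * prod_list (map (\<lambda>v. v + of_nat m) [- N])" for m
    unfolding w_def[symmetric] e w using assms(1) by (simp add: field_simps)
qed (use assms in \<open>auto simp: krawtchouk_lc_def gbinomial_pochhammer power_one_over
       simp flip: power_mult_distrib\<close>)

lemma monic_krawtchouk_hypergeo:
  assumes "p \<noteq> 0" "p \<noteq> 1" "pochhammer (- N) n \<noteq> 0"
  shows "poly (monic_krawtchouk p N n) x =
      pochhammer (- N) n * p ^ n * hypergeo [- of_nat n, - x] [- N] (1 / p)"
  unfolding monic_krawtchouk_def poly_smult krawtchouk_hypergeo[OF assms]
  by (simp add: krawtchouk_lc_def gbinomial_pochhammer flip: power_mult_distrib)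

lemma charlier_hypergeo:
  assumes "\<mu> \<noteq> 0"
  shows "poly (charlier \<mu> n) x = hypergeo [- of_nat n, - x] [] (- 1 / \<mu>)"
proof -
  have "poly (charlier \<mu> n) x = 1 * hypergeo [- of_nat n, - x] [] (- 1 / \<mu>)"
    unfolding charlier_def
    by (rule poly_the_sol_hypergeo[where b = 1 and e = \<mu>])
       (use assms in \<open>auto simp: charlier_lc_def\<close>)
  then show ?thesis by simp
qed

lemma monic_charlier_hypergeo:
  assumes "\<mu> \<noteq> 0"
  shows "poly (monic_charlier \<mu> n) x =
      (- \<mu>) ^ n * hypergeo [- of_nat n, - x] [] (- 1 / \<mu>)"
proof -
  have "1 / (- 1 / \<mu>) = - \<mu>" using assms by simp
  then have "1 / charlier_lc \<mu> n = (- \<mu>) ^ n"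
    unfolding charlier_lc_def by (metis power_one_over)
  then show ?thesis
    unfolding monic_charlier_def poly_smult charlier_hypergeo[OF assms] by simp
qed

theorem theorem6:
  shows
  "(\<forall>a b c d e P. monic_system a b c d e P \<longrightarrow>
      (\<forall>C. (\<forall>n x. poly (P n) x = (\<Sum>m\<le>n. C m n * falling_fact x m)) \<and>
           (\<forall>n m. m > n \<longrightarrow> C m n = 0) \<longrightarrow>
         (\<forall>n m :: nat.
            (a * of_nat n + a * of_nat m - a + d) * (of_nat n - of_nat m) * C m n
            + (of_nat m + 1)
              * (a * of_nat n ^ 2 - 2 * a * of_nat m ^ 2 - a * of_nat n - a * of_nat m
                 + of_nat n * d - 2 * d * of_nat m - b * of_nat m - d - e) * C (m + 1) n
            - (of_nat m + 1) * (of_nat m + 2)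
              * (a * of_nat m ^ 2 + 2 * a * of_nat m + d * of_nat m + b * of_nat m
                 + a + d + b + c + e) * C (m + 2) n = 0) \<and>
         (c = 0 \<longrightarrow> (\<forall>n m :: nat.
            (of_nat n - of_nat m) * (a * of_nat m + d + a * of_nat n - a) * C m n
            - (of_nat m + 1)
              * (a * of_nat m ^ 2 + of_nat m * b + of_nat m * d + e) * C (m + 1) n = 0))) \<and>
      (c = 0 \<longrightarrow> (\<forall>n x.
         (a \<noteq> 0 \<longrightarrow>
            (let rp = (b + d + csqrt ((b + d) ^ 2 - 4 * a * e)) / (2 * a);
                 rm = (b + d - csqrt ((b + d) ^ 2 - 4 * a * e)) / (2 * a)
             in pochhammer rp n \<noteq> 0 \<longrightarrow> pochhammer rm n \<noteq> 0 \<longrightarrow>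
                pochhammer (d / (2 * a)) n \<noteq> 0 \<longrightarrow> pochhammer ((d - a) / (2 * a)) n \<noteq> 0 \<longrightarrow>
                poly (P n) x =
                  pochhammer (d / a - 1) n * pochhammer rp n * pochhammer rm n
                  / (pochhammer (d / (2 * a)) n * pochhammer ((d - a) / (2 * a)) n) * (1 / 4) ^ n
                  * hypergeo [- of_nat n, - x, of_nat n - 1 + d / a] [rp, rm] 1)) \<and>
         (a = 0 \<longrightarrow> b + d \<noteq> 0 \<longrightarrow> pochhammer (e / (b + d)) n \<noteq> 0 \<longrightarrow>
            poly (P n) x =
              pochhammer (e / (b + d)) n * (1 + b / d) ^ n
              * hypergeo [- of_nat n, - x] [e / (b + d)] (d / (b + d))) \<and>
         (a = 0 \<longrightarrow> d = - b \<longrightarrow> e \<noteq> 0 \<longrightarrow>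
            poly (P n) x = (- e / b) ^ n * hypergeo [- of_nat n, - x] [] (- b / e)))))
   \<and>
   (\<forall>\<alpha> \<beta> N n x.
      pochhammer (of_nat n + 1 + \<alpha> + \<beta>) n \<noteq> 0 \<longrightarrow> pochhammer (\<beta> + 1) n \<noteq> 0 \<longrightarrow>
      pochhammer (1 - N) n \<noteq> 0 \<longrightarrow>
        poly (hahn_h \<alpha> \<beta> N n) x =
          (- 1) ^ n / fact n * pochhammer (\<beta> + 1) n * pochhammer (N - of_nat n) n
          * hypergeo [- of_nat n, - x, of_nat n + 1 + \<alpha> + \<beta>] [\<beta> + 1, 1 - N] 1 \<and>
        poly (monic_hahn_h \<alpha> \<beta> N n) x =
          pochhammer (1 + \<beta>) n * pochhammer (1 - N) n / pochhammer (1 + of_nat n + \<alpha> + \<beta>) n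
          * hypergeo [- of_nat n, - x, of_nat n + 1 + \<alpha> + \<beta>] [\<beta> + 1, 1 - N] 1)
   \<and>
   (\<forall>N n x. pochhammer (1 - N) n \<noteq> 0 \<longrightarrow>
        poly (cheb_t N n) x =
          (- 1) ^ n * pochhammer (N - of_nat n) n
          * hypergeo [- of_nat n, - x, of_nat n + 1] [1, 1 - N] 1 \<and>
        poly (monic_cheb_t N n) x =
          fact n * pochhammer (1 - N) n / (pochhammer (1 / 2) n * 4 ^ n)
          * hypergeo [- of_nat n, - x, of_nat n + 1] [1, 1 - N] 1)
   \<and>
   (\<forall>\<alpha> \<beta> N n x.
      pochhammer (of_nat n + 1 + \<alpha> + \<beta>) n \<noteq> 0 \<longrightarrow> pochhammer (\<alpha> + 1) n \<noteq> 0 \<longrightarrow>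
      pochhammer (- N) n \<noteq> 0 \<longrightarrow>
        poly (hahn_Q \<alpha> \<beta> N n) x =
          hypergeo [- of_nat n, - x, of_nat n + 1 + \<alpha> + \<beta>] [\<alpha> + 1, - N] 1 \<and>
        poly (monic_hahn_Q \<alpha> \<beta> N n) x = poly (monic_hahn_h \<beta> \<alpha> (N + 1) n) x)
   \<and>
   (\<forall>\<gamma> \<mu> n x. \<mu> \<noteq> 0 \<longrightarrow> \<mu> \<noteq> 1 \<longrightarrow> pochhammer \<gamma> n \<noteq> 0 \<longrightarrow>
        poly (meixner \<gamma> \<mu> n) x =
          pochhammer \<gamma> n * hypergeo [- of_nat n, - x] [\<gamma>] (1 - 1 / \<mu>) \<and>
        poly (monic_meixner \<gamma> \<mu> n) x =
          pochhammer \<gamma> n * (\<mu> / (\<mu> - 1)) ^ n * hypergeo [- of_nat n, - x] [\<gamma>] (1 - 1 / \<mu>))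
   \<and>
   (\<forall>p N n x. p \<noteq> 0 \<longrightarrow> p \<noteq> 1 \<longrightarrow> pochhammer (- N) n \<noteq> 0 \<longrightarrow>
        poly (krawtchouk p N n) x =
          (- 1) ^ n * (N gchoose n) * p ^ n * hypergeo [- of_nat n, - x] [- N] (1 / p) \<and>
        poly (monic_krawtchouk p N n) x =
          pochhammer (- N) n * p ^ n * hypergeo [- of_nat n, - x] [- N] (1 / p))
   \<and>
   (\<forall>\<mu> n x. \<mu> \<noteq> 0 \<longrightarrow>
        poly (charlier \<mu> n) x = hypergeo [- of_nat n, - x] [] (- 1 / \<mu>) \<and>
        poly (monic_charlier \<mu> n) x =
          (- \<mu>) ^ n * hypergeo [- of_nat n, - x] [] (- 1 / \<mu>))"
  unfolding Let_def
  apply (intro conjI allI impI)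
  subgoal by (rule monic_system_three_term) blast+
  subgoal by (rule monic_system_two_term) blast+
  subgoal by (rule monic_system_3F2) blast+
  subgoal by (rule monic_system_2F1) blast+
  subgoal by (rule monic_system_2F0) blast+
  subgoal by (rule hahn_h_hypergeo)
  subgoal by (rule monic_hahn_h_hypergeo)
  subgoal by (rule cheb_t_hypergeo)
  subgoal by (rule cheb_t_hypergeo)
  subgoal by (rule hahn_Q_hypergeo)
  subgoal by (rule monic_hahn_Q_eq_monic_hahn_h)
  subgoal by (rule meixner_hypergeo)
  subgoal by (rule monic_meixner_hypergeo)
  subgoal by (rule krawtchouk_hypergeo)
  subgoal by (rule monic_krawtchouk_hypergeo)
  subgoal by (rule charlier_hypergeo)
  subgoal by (rule monic_charlier_hypergeo)
  done

end
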